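(* Let $n\geq 4$ and $0\leq k\leq n-3$. Among all connected graphs on $n$ vertices with exactly $k$ pendant vertices, the graph $P_n^k$ has the maximum core index. Furthermore, $$F(P_n^k)=(2^k-1)\bigl(F(K_{n-k})-F(K_{n-k-1})\bigr)+F(K_{n-k})+k,$$ where $F(K_m)=\sum_{i=1}^{m}\binom{m}{i}h_i$.
   Context: All graphs are finite, simple and undirected. A pendant vertex is a vertex of degree one. $P_n^k$ is the graph obtained from the complete graph $K_{n-k}$ by attaching $k$ new pendant vertices to a single vertex of $K_{n-k}$. $h_i$ is the number of connected labeled graphs on $i$ labeled vertices. A connected subgraph of a graph $G=(V,E)$ is a graph $(V',E')$ with $\emptyset\neq V'\subseteq V$, $E'\subseteq E$, every edge of $E'$ having both endpoints in $V'$, and $(V',E')$ connected; distinct pairs $(V',E')$ are counted separately. The core index $F(G)$ is the number of connected subgraphs of $G$. *)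

theory Defs
  imports Main
begin

text \<open>A graph is a pair (V, E) whose edges are two-element sets of vertices.\<close>

type_synonym 'a graph = "'a set \<times> 'a set set"

abbreviation verts :: "'a graph \<Rightarrow> 'a set" where
  "verts G \<equiv> fst G"

abbreviation edges :: "'a graph \<Rightarrow> 'a set set" where
  "edges G \<equiv> snd G"

definition simple_graph :: "'a graph \<Rightarrow> bool" where
  "simple_graph G \<longleftrightarrow> finite (verts G) \<and> (\<forall>e\<in>edges G. e \<subseteq> verts G \<and> card e = 2)"

definition adj_rel :: "'a graph \<Rightarrow> ('a \<times> 'a) set" where
  "adj_rel G = {(u, v). {u, v} \<in> edges G}"

definition connected_graph :: "'a graph \<Rightarrow> bool" where
  "connected_graph G \<longleftrightarrow>
     verts G \<noteq> {} \<and> (\<forall>u\<in>verts G. \<forall>v\<in>verts G. (u, v) \<in> (adj_rel G)\<^sup>*)"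

definition degree :: "'a graph \<Rightarrow> 'a \<Rightarrow> nat" where
  "degree G v = card {e \<in> edges G. v \<in> e}"

definition pendant_vertices :: "'a graph \<Rightarrow> 'a set" where
  "pendant_vertices G = {v \<in> verts G. degree G v = 1}"

definition connected_graphs_with_pendants :: "nat \<Rightarrow> nat \<Rightarrow> 'a graph set" where
  "connected_graphs_with_pendants n k =
     {G. simple_graph G \<and> connected_graph G \<and> card (verts G) = n \<and>
         card (pendant_vertices G) = k}"

definition connected_subgraphs :: "'a graph \<Rightarrow> 'a graph set" where
  "connected_subgraphs G =
     {H. verts H \<noteq> {} \<and> verts H \<subseteq> verts G \<and> edges H \<subseteq> edges G \<and>
         (\<forall>e\<in>edges H. e \<subseteq> verts H) \<and> connected_graph H}"

definition core_index :: "'a graph \<Rightarrow> nat" where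
  "core_index G = card (connected_subgraphs G)"

definition complete_graph :: "nat \<Rightarrow> nat graph" where
  "complete_graph m = ({..<m}, {e. e \<subseteq> {..<m} \<and> card e = 2})"

text \<open>The graph \<open>P\<^sub>n\<^sup>k\<close>: the clique lives on \<open>{..<n - k}\<close>, the pendant vertices are
  \<open>{n - k..<n}\<close>, all attached to the clique vertex \<open>0\<close>. Meaningful for \<open>k < n\<close>.\<close>

definition pendant_clique :: "nat \<Rightarrow> nat \<Rightarrow> nat graph" where
  "pendant_clique n k =
     ({..<n}, edges (complete_graph (n - k)) \<union> {{0, j} | j. j \<in> {n - k..<n}})"

text \<open>The number \<open>h\<^sub>i\<close> of connected labeled graphs on \<open>i\<close> labeled vertices.\<close>

definition num_connected_labeled :: "nat \<Rightarrow> nat" where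
  "num_connected_labeled i =
     card {G :: nat graph. simple_graph G \<and> verts G = {..<i} \<and> connected_graph G}"

end

theory Submission
  imports Defs
begin

text \<open>Let \<open>L\<close> be the set of the \<open>k\<close> pendant vertices of \<open>G\<close>, let \<open>C\<close> be the set of the other
  \<open>m = n - k\<close> vertices and let \<open>f l \<in> C\<close> be the neighbour of \<open>l \<in> L\<close>. A connected subgraph of
  \<open>G\<close> is either a single pendant vertex, or it consists of a set \<open>A \<subseteq> L\<close> and a connected subgraph
  of \<open>G[C]\<close> whose vertex set contains \<open>f ` A\<close>. For \<open>A \<noteq> {}\<close> the number of the latter is at most
  the number of connected subgraphs of a clique on \<open>C\<close> that contain one prescribed vertex, which
  is \<open>F(K\<^sub>m) - F(K\<^sub>m\<^sub>-\<^sub>1)\<close>. Summing over \<open>A\<close> gives the bound, with equality if \<open>f\<close> is constant and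
  \<open>G[C]\<close> is complete.\<close>

section \<open>Cliques, connected graphs on a fixed vertex set, and attaching pendant
  vertices\<close>

definition clique :: "'a set \<Rightarrow> 'a graph" where
  "clique S = (S, {e. e \<subseteq> S \<and> card e = 2})"

definition connected_graphs_on :: "'a set \<Rightarrow> 'a graph set" where
  "connected_graphs_on S = {G. simple_graph G \<and> verts G = S \<and> connected_graph G}"

text \<open>One operation covers both the whole graph, as an extension of its non-pendant part, and
  its connected subgraphs, as extensions by a subset of the same pendant vertices. Only the values
  of \<open>f\<close> on \<open>A\<close> matter.\<close>

definition pendant_extension :: "('a \<Rightarrow> 'a) \<Rightarrow> 'a set \<Rightarrow> 'a graph \<Rightarrow> 'a graph" where
  "pendant_extension f A H = (verts H \<union> A, edges H \<union> (\<lambda>l. {f l, l}) ` A)"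

lemma complete_graph_eq_clique: "complete_graph m = clique {..<m}"
  by (simp add: complete_graph_def clique_def)

lemma finite_connected_graphs_on:
  assumes "finite S" shows "finite (connected_graphs_on S)"
proof (rule finite_subset)
  show "connected_graphs_on S \<subseteq> {S} \<times> Pow (Pow S)"
    by (auto simp: connected_graphs_on_def simple_graph_def)
qed (use assms in auto)

lemma finite_connected_subgraphs:
  assumes "finite (verts G)" shows "finite (connected_subgraphs G)"
proof (rule finite_subset)
  show "connected_subgraphs G \<subseteq> Pow (verts G) \<times> Pow (Pow (verts G))"
    unfolding connected_subgraphs_def by force
qed (use assms in auto)

lemma adj_rel_sym: "(u, v) \<in> (adj_rel G)\<^sup>* \<Longrightarrow> (v, u) \<in> (adj_rel G)\<^sup>*"
proof -
  have "sym (adj_rel G)" by (auto simp: adj_rel_def sym_def insert_commute)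
  then show "(u, v) \<in> (adj_rel G)\<^sup>* \<Longrightarrow> (v, u) \<in> (adj_rel G)\<^sup>*"
    by (meson sym_rtrancl symD)
qed

lemma connected_graphI:
  assumes "c \<in> verts G" "\<And>v. v \<in> verts G \<Longrightarrow> (v, c) \<in> (adj_rel G)\<^sup>*"
  shows "connected_graph G"
  unfolding connected_graph_def
proof (intro conjI ballI)
  show "verts G \<noteq> {}" using assms(1) by blast
  show "(u, v) \<in> (adj_rel G)\<^sup>*" if "u \<in> verts G" "v \<in> verts G" for u v
    using assms(2)[OF that(1)] adj_rel_sym[OF assms(2)[OF that(2)]] by (rule rtrancl_trans)
qed

text \<open>The image of one step may be a whole walk or a single point. The second case is needed
  when pendant edges are contracted.\<close>

lemma rtrancl_map:
  assumes "(u, v) \<in> r\<^sup>*" "\<And>x y. (x, y) \<in> r \<Longrightarrow> (g x, g y) \<in> s\<^sup>*"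
  shows "(g u, g v) \<in> s\<^sup>*"
  using assms(1)
proof induction
  case (step y z)
  then show ?case using assms(2)[of y z] by (meson rtrancl_trans)
qed simp

section \<open>Invariance of the number of connected graphs under relabelling\<close>

text \<open>Relabelling vertices and edges along \<open>f\<close> is injective on graphs and
  preserves connectedness. An inequality is enough, since it can be applied to a bijection and to
  its inverse.\<close>

lemma card_connected_graphs_on_le:
  assumes f: "inj_on f S" and fin: "finite S"
  shows "card (connected_graphs_on S) \<le> card (connected_graphs_on (f ` S))"
proof (rule card_inj_on_le)
  let ?F = "\<lambda>G. (f ` verts G, (`) f ` edges G)"
  show "finite (connected_graphs_on (f ` S))"
    using fin by (simp add: finite_connected_graphs_on)
  have sub: "edges G \<subseteq> Pow S" if "G \<in> connected_graphs_on S" for G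
    using that by (auto simp: connected_graphs_on_def simple_graph_def)
  show "inj_on ?F (connected_graphs_on S)"
  proof (rule inj_onI)
    fix G H assume GH: "G \<in> connected_graphs_on S" "H \<in> connected_graphs_on S" "?F G = ?F H"
    have "inj_on ((`) f) (Pow S)" using f by (rule inj_on_image_Pow)
    then have "edges G = edges H"
      using GH sub by (metis inj_on_image_eq_iff prod.inject)
    moreover have "verts G = verts H"
      using GH by (simp add: connected_graphs_on_def)
    ultimately show "G = H" by (simp add: prod_eq_iff)
  qed
  show "?F ` connected_graphs_on S \<subseteq> connected_graphs_on (f ` S)"
  proof clarify
    fix G assume G: "G \<in> connected_graphs_on S"
    have "card (f ` e) = 2" if "e \<in> edges G" for e
      using that G f sub by (metis (mono_tags, lifting) Pow_iff card_image connected_graphs_on_def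
          inj_on_subset mem_Collect_eq simple_graph_def subset_eq)
    then have simple: "simple_graph (?F G)"
      using G fin by (auto simp: connected_graphs_on_def simple_graph_def)
    have "(f u, f v) \<in> (adj_rel (?F G))\<^sup>*" if "(u, v) \<in> (adj_rel G)\<^sup>*" for u v
      using that
    proof (rule rtrancl_map)
      fix x y assume "(x, y) \<in> adj_rel G"
      then have "f ` {x, y} \<in> (`) f ` edges G" unfolding adj_rel_def by blast
      then show "(f x, f y) \<in> (adj_rel (?F G))\<^sup>*" by (simp add: adj_rel_def r_into_rtrancl)
    qed
    then have "connected_graph (?F G)"
      using G by (auto simp: connected_graphs_on_def connected_graph_def)
    then show "?F G \<in> connected_graphs_on (f ` S)"
      using simple G by (simp add: connected_graphs_on_def)
  qed
qed

lemma card_connected_graphs_on: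
  assumes "finite S"
  shows "card (connected_graphs_on S) = num_connected_labeled (card S)"
proof -
  obtain f where f: "bij_betw f S {..<card S}"
    using ex_bij_betw_finite_nat[OF assms] atLeast0LessThan by metis
  then have g: "bij_betw (inv_into S f) {..<card S} S" by (rule bij_betw_inv_into)
  have "card (connected_graphs_on S) = card (connected_graphs_on {..<card S})"
    using card_connected_graphs_on_le[of f S] card_connected_graphs_on_le[of "inv_into S f" "{..<card S}"]
      f g assms by (simp add: bij_betw_def)
  then show ?thesis by (simp add: num_connected_labeled_def connected_graphs_on_def)
qed

section \<open>Connected subgraphs of complete graphs\<close>

text \<open>Every simple graph on a subset \<open>T\<close> of \<open>S\<close> is a subgraph of the
  clique, so only connectedness and \<open>T \<noteq> {}\<close> remain as conditions.\<close>

lemma connected_subgraphs_clique: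
  assumes "finite S"
  shows "connected_subgraphs (clique S) = (\<Union>T\<in>Pow S - {{}}. connected_graphs_on T)"
  using assms
  by (auto simp: connected_subgraphs_def clique_def connected_graphs_on_def simple_graph_def
      intro: finite_subset dest: finite_subset)

text \<open>Connected subgraphs are sorted by vertex set, and the vertex sets by size.\<close>

lemma core_index_clique_eq_sum:
  assumes "finite S"
  shows "core_index (clique S) = (\<Sum>i = 1..card S. (card S choose i) * num_connected_labeled i)"
proof -
  have "core_index (clique S) = (\<Sum>T\<in>Pow S - {{}}. card (connected_graphs_on T))"
    unfolding core_index_def connected_subgraphs_clique[OF assms]
  proof (rule card_UN_disjoint)
    show "\<forall>T\<in>Pow S - {{}}. finite (connected_graphs_on T)"
      using assms by (auto intro!: finite_connected_graphs_on intro: finite_subset)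
  qed (use assms in \<open>auto simp: connected_graphs_on_def\<close>)
  also have "\<dots> = (\<Sum>T\<in>Pow S - {{}}. num_connected_labeled (card T))"
    using assms by (intro sum.cong) (auto intro!: card_connected_graphs_on intro: finite_subset)
  also have "\<dots> = (\<Sum>i = 1..card S. \<Sum>T\<in>{T \<in> Pow S - {{}}. card T = i}. num_connected_labeled (card T))"
  proof (rule sum.group[symmetric])
    \<comment> \<open>Leaving out the empty set is what makes the sum start at 1.\<close>
    show "card ` (Pow S - {{}}) \<subseteq> {1..card S}"
      using assms finite_subset[OF _ assms] by (auto simp: card_mono Suc_le_eq card_gt_0_iff)
  qed (use assms in auto)
  also have "\<dots> = (\<Sum>i = 1..card S. (card S choose i) * num_connected_labeled i)"
  proof (rule sum.cong[OF refl])
    fix i assume "i \<in> {1..card S}"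
    then have "{T \<in> Pow S - {{}}. card T = i} = {T. T \<subseteq> S \<and> card T = i}" by auto
    then show "(\<Sum>T\<in>{T \<in> Pow S - {{}}. card T = i}. num_connected_labeled (card T))
        = (card S choose i) * num_connected_labeled i"
      using n_subsets[OF assms, of i] by simp
  qed
  finally show ?thesis .
qed

lemma core_index_clique:
  assumes "finite S" shows "core_index (clique S) = core_index (complete_graph (card S))"
  using assms by (simp add: complete_graph_eq_clique core_index_clique_eq_sum)

text \<open>The connected subgraphs avoiding \<open>c\<close> are exactly those of the clique on
  \<open>C - {c}\<close>. Hence the number of those containing \<open>c\<close> is the same for
  every \<open>c\<close> and depends only on \<open>card C\<close>. The additive form avoids
  truncated subtraction.\<close>

lemma card_connected_subgraphs_clique_containing:
  assumes "finite C" "c \<in> C"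
  shows "card {H \<in> connected_subgraphs (clique C). c \<in> verts H}
       + core_index (complete_graph (card C - 1)) = core_index (complete_graph (card C))"
proof -
  let ?A = "{H \<in> connected_subgraphs (clique C). c \<in> verts H}"
  let ?B = "connected_subgraphs (clique (C - {c}))"
  have un: "connected_subgraphs (clique C) = ?A \<union> ?B"
    unfolding connected_subgraphs_def clique_def by auto
  have "finite ?A" "finite ?B"
    using assms by (auto simp: finite_connected_subgraphs clique_def)
  moreover have "?A \<inter> ?B = {}"
    unfolding connected_subgraphs_def clique_def by auto
  ultimately have "card (connected_subgraphs (clique C)) = card ?A + card ?B"
    by (subst un) (rule card_Un_disjoint)
  then show ?thesis
    using core_index_clique[of C] core_index_clique[of "C - {c}"] assms
    by (simp add: core_index_def)
qed

section \<open>Connected subgraphs of a graph with attached pendant vertices\<close>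

lemma connected_graph_pendant_extension:
  assumes "connected_graph H" "f ` A \<subseteq> verts H"
  shows "connected_graph (pendant_extension f A H)"
proof -
  let ?G = "pendant_extension f A H"
  obtain c where c: "c \<in> verts H" using assms(1) by (auto simp: connected_graph_def)
  have sub: "adj_rel H \<subseteq> adj_rel ?G" by (auto simp: adj_rel_def pendant_extension_def)
  have H: "(v, c) \<in> (adj_rel ?G)\<^sup>*" if "v \<in> verts H" for v
    using that assms(1) c rtrancl_mono[OF sub] by (auto simp: connected_graph_def)
  show ?thesis
  proof (rule connected_graphI)
    show "c \<in> verts ?G" using c by (simp add: pendant_extension_def)
    fix v assume "v \<in> verts ?G"
    then consider "v \<in> verts H" | "v \<in> A" by (auto simp: pendant_extension_def)
    then show "(v, c) \<in> (adj_rel ?G)\<^sup>*"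
    proof cases
      case 2
      then have "(v, f v) \<in> adj_rel ?G"
        by (auto simp: adj_rel_def pendant_extension_def insert_commute)
      moreover have "(f v, c) \<in> (adj_rel ?G)\<^sup>*" using H assms(2) 2 by blast
      ultimately show ?thesis by (rule converse_rtrancl_into_rtrancl)
    qed (rule H)
  qed
qed

context
  fixes C L :: "'a set" and E :: "'a set set" and f :: "'a \<Rightarrow> 'a"
  assumes fin: "finite C" "finite L" and disj: "C \<inter> L = {}" and f: "f ` L \<subseteq> C"
    and E: "\<And>e. e \<in> E \<Longrightarrow> e \<subseteq> C \<and> card e = 2"
begin

text \<open>If \<open>H\<close> misses \<open>C\<close>, it has no edges and is a single vertex.
  Otherwise \<open>H\<close> is cut down to \<open>C\<close>, and connectedness forces the edge at
  each of its pendant vertices to be present.\<close>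

lemma connected_subgraph_pendant_extensionE:
  assumes "H \<in> connected_subgraphs (pendant_extension f L (C, E))"
  obtains l where "l \<in> L" "H = ({l}, {})"
  | A H' where "A \<subseteq> L" "H' \<in> connected_subgraphs (C, E)" "f ` A \<subseteq> verts H'"
      "H = pendant_extension f A H'"
proof -
  have V: "verts H \<subseteq> C \<union> L" "verts H \<noteq> {}"
    and Ed: "\<And>e. e \<in> edges H \<Longrightarrow> e \<subseteq> verts H \<and> (e \<in> E \<or> (\<exists>l\<in>L. e = {f l, l}))"
    and con: "\<And>u v. u \<in> verts H \<Longrightarrow> v \<in> verts H \<Longrightarrow> (u, v) \<in> (adj_rel H)\<^sup>*"
    using assms by (auto simp: connected_subgraphs_def pendant_extension_def connected_graph_def)
  show thesis
  proof (cases "verts H \<inter> C = {}")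
    case True
    have "edges H = {}"
    proof (rule ccontr)
      assume "edges H \<noteq> {}"
      then obtain e where e: "e \<in> edges H" by blast
      \<comment> \<open>Edges from \<open>E\<close> lie inside \<open>C\<close>, and a pendant edge
        has its end \<open>f l\<close> there.\<close>
      then have "e \<inter> C \<noteq> {}" using Ed[OF e] E[of e] f by (auto simp: card_2_iff)
      then show False using Ed[OF e] True by blast
    qed
    obtain l where l: "l \<in> verts H" using V by blast
    have "v = l" if "v \<in> verts H" for v
    proof -
      have "adj_rel H = {}" using \<open>edges H = {}\<close> by (simp add: adj_rel_def)
      then show ?thesis using con[OF that l] by simp
    qed
    then have "verts H = {l}" using l by blast
    then have "H = ({l}, {})" using \<open>edges H = {}\<close> by (simp add: prod_eq_iff)
    moreover have "l \<in> L" using l V True by blast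
    ultimately show ?thesis using that(1) by blast
  next
    case False
    then obtain c where c: "c \<in> verts H" "c \<in> C" by blast
    define A where "A = verts H \<inter> L"
    define H' where "H' = (verts H \<inter> C, edges H \<inter> E)"
    \<comment> \<open>A walk in \<open>H\<close> from \<open>l\<close> to
      \<open>c \<noteq> l\<close> leaves \<open>l\<close> by some edge, and the only candidate is
      the pendant edge.\<close>
    have pend: "{f l, l} \<in> edges H" if "l \<in> A" for l
    proof -
      have l: "l \<in> verts H" "l \<in> L" "l \<noteq> c" using that c disj by (auto simp: A_def)
      then obtain y where "(l, y) \<in> adj_rel H"
        using con[OF l(1) c(1)] by (metis converse_rtranclE)
      then have y: "{l, y} \<in> edges H" by (simp add: adj_rel_def)
      moreover have "{l, y} \<notin> E" using E[of "{l, y}"] l disj by auto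
      ultimately obtain l' where "l' \<in> L" "{l, y} = {f l', l'}" using Ed[OF y] by blast
      moreover have "l \<noteq> f l'" using \<open>l' \<in> L\<close> f l disj by blast
      ultimately have "{l, y} = {f l, l}" by (auto simp: doubleton_eq_iff)
      then show ?thesis using y by simp
    qed
    have fA: "f ` A \<subseteq> verts H'"
      using pend Ed f by (fastforce simp: H'_def A_def)
    have "H = pendant_extension f A H'"
      unfolding pendant_extension_def prod_eq_iff
    proof
      show "verts H = verts (verts H' \<union> A, edges H' \<union> (\<lambda>l. {f l, l}) ` A)"
        using V by (auto simp: H'_def A_def)
      show "edges H = edges (verts H' \<union> A, edges H' \<union> (\<lambda>l. {f l, l}) ` A)"
        using pend Ed by (fastforce simp: H'_def A_def)
    qed
    moreover have "H' \<in> connected_subgraphs (C, E)"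
    proof -
      \<comment> \<open>The retraction onto \<open>C\<close> fixes the edges in \<open>E\<close> and
        contracts each pendant edge to a point, so it turns walks of \<open>H\<close> into walks of
        \<open>H'\<close>.\<close>
      define r where "r x = (if x \<in> L then f x else x)" for x
      have r: "r x = x" if "x \<in> C" for x using that disj by (auto simp: r_def)
      have "(r u, r v) \<in> (adj_rel H')\<^sup>*" if "(u, v) \<in> (adj_rel H)\<^sup>*" for u v
        using that
      proof (rule rtrancl_map)
        fix x y assume "(x, y) \<in> adj_rel H"
        then have xy: "{x, y} \<in> edges H" by (simp add: adj_rel_def)
        show "(r x, r y) \<in> (adj_rel H')\<^sup>*"
        proof (cases "{x, y} \<in> E")
          case True
          then have "r x = x" "r y = y" using E[OF True] r by auto
          moreover have "(x, y) \<in> adj_rel H'" using True xy by (simp add: adj_rel_def H'_def)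
          ultimately show ?thesis by auto
        next
          case False
          then obtain l where l: "l \<in> L" "{x, y} = {f l, l}" using Ed[OF xy] by blast
          moreover have "r (f l) = f l" using l f r by blast
          moreover have "r l = f l" using l by (simp add: r_def)
          ultimately have "r x = r y" by (auto simp: doubleton_eq_iff)
          then show ?thesis by simp
        qed
      qed
      then have "(u, v) \<in> (adj_rel H')\<^sup>*" if "u \<in> verts H'" "v \<in> verts H'" for u v
        using con[of u v] r[of u] r[of v] that by (metis H'_def IntE fst_conv)
      then have "connected_graph H'"
        using c unfolding connected_graph_def H'_def by auto
      moreover have "e \<subseteq> verts H'" if "e \<in> edges H'" for e
        using that Ed[of e] E[of e] by (simp add: H'_def)
      ultimately show ?thesis
        using c by (auto simp: connected_subgraphs_def H'_def)
    qed
    moreover have "A \<subseteq> L" by (simp add: A_def)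
    ultimately show ?thesis using that(2) fA by blast
  qed
qed

lemma connected_subgraphs_pendant_extension:
  "connected_subgraphs (pendant_extension f L (C, E)) =
     (\<lambda>l. ({l}, {})) ` L \<union>
     (\<lambda>(A, H). pendant_extension f A H) `
       (SIGMA A:Pow L. {H \<in> connected_subgraphs (C, E). f ` A \<subseteq> verts H})"
  (is "?X = ?S \<union> ?P ` ?T")
proof
  show "?X \<subseteq> ?S \<union> ?P ` ?T"
  proof
    fix H assume "H \<in> ?X"
    then show "H \<in> ?S \<union> ?P ` ?T"
      by (cases rule: connected_subgraph_pendant_extensionE) force+
  qed
  have "?S \<subseteq> ?X"
    by (auto simp: connected_subgraphs_def pendant_extension_def connected_graph_def)
  moreover have "pendant_extension f A H \<in> ?X"
    if "A \<subseteq> L" "H \<in> connected_subgraphs (C, E)" "f ` A \<subseteq> verts H" for A H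
  proof -
    have "connected_graph (pendant_extension f A H)"
      using that by (intro connected_graph_pendant_extension) (auto simp: connected_subgraphs_def)
    then show ?thesis
      using that by (auto simp: connected_subgraphs_def pendant_extension_def)
  qed
  ultimately show "?S \<union> ?P ` ?T \<subseteq> ?X" by auto
qed

text \<open>The two kinds of connected subgraphs are disjoint, because the second kind always has a
  vertex in \<open>C\<close>. The pair \<open>(A, H)\<close> is determined by its extension, so the
  second kind is counted by summing over \<open>A\<close>.\<close>

lemma core_index_pendant_extension:
  "core_index (pendant_extension f L (C, E)) =
     card L + (\<Sum>A\<in>Pow L. card {H \<in> connected_subgraphs (C, E). f ` A \<subseteq> verts H})"
proof -
  let ?T = "SIGMA A:Pow L. {H \<in> connected_subgraphs (C, E). f ` A \<subseteq> verts H}"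
  let ?P = "\<lambda>(A, H). pendant_extension f A H"
  let ?S = "(\<lambda>l. ({l}, {} :: 'a set set)) ` L"
  have finC: "finite (connected_subgraphs (C, E))"
    using fin by (simp add: finite_connected_subgraphs)
  have "?S \<inter> ?P ` ?T = {}"
    using disj by (auto simp: connected_subgraphs_def pendant_extension_def)
  moreover have "finite ?T" using fin finC by auto
  moreover have "inj_on ?P ?T"
  proof (rule inj_onI)
    fix p q assume p: "p \<in> ?T" and q: "q \<in> ?T" and eq: "?P p = ?P q"
    \<comment> \<open>Both components can be read off the extended graph.\<close>
    have rec: "A = verts (pendant_extension f A H) \<inter> L"
      "verts H = verts (pendant_extension f A H) \<inter> C"
      "edges H = edges (pendant_extension f A H) \<inter> Pow C" if "(A, H) \<in> ?T" for A H
    proof -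
      have H: "A \<subseteq> L" "verts H \<subseteq> C" "edges H \<subseteq> Pow C"
        using that E by (auto simp: connected_subgraphs_def)
      show "A = verts (pendant_extension f A H) \<inter> L"
        "verts H = verts (pendant_extension f A H) \<inter> C"
        using H disj by (auto simp: pendant_extension_def)
      show "edges H = edges (pendant_extension f A H) \<inter> Pow C"
        using H disj by (auto simp: pendant_extension_def)
    qed
    obtain A H where p': "p = (A, H)" by (cases p)
    obtain B K where q': "q = (B, K)" by (cases q)
    have "A = B" "verts H = verts K" "edges H = edges K"
      using rec[of A H] rec[of B K] p q eq unfolding p' q' by simp_all
    then show "p = q" by (simp add: p' q' prod_eq_iff)
  qed
  ultimately have "core_index (pendant_extension f L (C, E)) = card ?S + card ?T"
    unfolding core_index_def connected_subgraphs_pendant_extension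
    using fin by (subst card_Un_disjoint) (auto simp: card_image)
  also have "card ?S = card L" by (intro card_image) (auto simp: inj_on_def)
  also have "card ?T = (\<Sum>A\<in>Pow L. card {H \<in> connected_subgraphs (C, E). f ` A \<subseteq> verts H})"
    using fin finC by (intro card_SigmaI) auto
  finally show ?thesis .
qed

text \<open>The term for \<open>A = {}\<close> is at most the core index of the clique on
  \<open>C\<close>. In each of the other \<open>2 ^ card L - 1\<close> terms, the condition is
  weakened to containing \<open>f l\<close> for one \<open>l \<in> A\<close>, and \<open>E\<close>
  is enlarged to all pairs.\<close>

lemma core_index_pendant_extension_le:
  assumes c: "c \<in> C"
  shows "core_index (pendant_extension f L (C, E)) \<le> card L + core_index (complete_graph (card C))
    + (2 ^ card L - 1) * card {H \<in> connected_subgraphs (clique C). c \<in> verts H}"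
proof -
  let ?N = "\<lambda>A. card {H \<in> connected_subgraphs (C, E). f ` A \<subseteq> verts H}"
  let ?M = "card {H \<in> connected_subgraphs (clique C). c \<in> verts H}"
  have sub: "connected_subgraphs (C, E) \<subseteq> connected_subgraphs (clique C)"
    using E unfolding connected_subgraphs_def clique_def by auto
  have finC: "finite (connected_subgraphs (clique C))"
    using fin by (simp add: finite_connected_subgraphs clique_def)
  have "?N {} \<le> core_index (clique C)"
    unfolding core_index_def using sub finC by (intro card_mono) auto
  moreover have "?N A \<le> ?M" if A: "A \<in> Pow L - {{}}" for A
  proof -
    obtain l where l: "l \<in> A" using A by blast
    have "?N A \<le> card {H \<in> connected_subgraphs (clique C). f l \<in> verts H}"
      using l sub finC by (intro card_mono) auto
    \<comment> \<open>The count does not depend on the prescribed vertex: for \<open>f l\<close> and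
      for \<open>c\<close>, adding the same core index of the smaller clique gives the same
      total.\<close>
    also have "\<dots> = ?M"
      using card_connected_subgraphs_clique_containing[OF fin(1), of "f l"]
        card_connected_subgraphs_clique_containing[OF fin(1) c] l A f by fastforce
    finally show ?thesis .
  qed
  then have "(\<Sum>A\<in>Pow L - {{}}. ?N A) \<le> card (Pow L - {{}}) * ?M"
    using sum_bounded_above[of "Pow L - {{}}" ?N ?M] by simp
  moreover have "card (Pow L - {{}}) = 2 ^ card L - 1"
    using fin by (simp add: card_Pow)
  moreover have "(\<Sum>A\<in>Pow L. ?N A) = ?N {} + (\<Sum>A\<in>Pow L - {{}}. ?N A)"
    using fin by (subst sum.remove[of _ "{}"]) auto
  ultimately show ?thesis
    using core_index_clique[OF fin(1)] core_index_pendant_extension by simp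
qed

end

text \<open>The equality case of the bound: for constant \<open>f\<close>, every nonempty
  \<open>A\<close> imposes the same single condition \<open>c \<in> verts H\<close>.\<close>

lemma core_index_pendant_extension_clique:
  assumes "finite C" "finite L" "C \<inter> L = {}" "c \<in> C"
  shows "core_index (pendant_extension (\<lambda>_. c) L (clique C))
    = card L + core_index (complete_graph (card C))
      + (2 ^ card L - 1) * card {H \<in> connected_subgraphs (clique C). c \<in> verts H}"
proof -
  let ?N = "\<lambda>A. card {H \<in> connected_subgraphs (clique C). (\<lambda>_. c) ` A \<subseteq> verts H}"
  let ?M = "card {H \<in> connected_subgraphs (clique C). c \<in> verts H}"
  have "core_index (pendant_extension (\<lambda>_. c) L (clique C)) = card L + (\<Sum>A\<in>Pow L. ?N A)"
    unfolding clique_def using assms by (intro core_index_pendant_extension) auto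
  also have "(\<Sum>A\<in>Pow L. ?N A) = ?N {} + (\<Sum>A\<in>Pow L - {{}}. ?N A)"
    using assms by (subst sum.remove[of _ "{}"]) auto
  also have "(\<Sum>A\<in>Pow L - {{}}. ?N A) = (\<Sum>A\<in>Pow L - {{}}. ?M)"
    by (intro sum.cong) (auto simp: image_constant_conv)
  also have "\<dots> = (2 ^ card L - 1) * ?M"
    using assms by (simp add: card_Pow)
  finally show ?thesis
    using core_index_clique[of C] assms by (simp add: core_index_def)
qed

section \<open>Splitting a connected graph into its pendant vertices and the rest\<close>

lemma pendant_vertex_edgeE:
  assumes "simple_graph G" "v \<in> pendant_vertices G"
  obtains w where "w \<in> verts G" "w \<noteq> v" "{e \<in> edges G. v \<in> e} = {{w, v}}"
proof -
  obtain e where e: "{e \<in> edges G. v \<in> e} = {e}"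
    using assms(2) by (auto simp: pendant_vertices_def degree_def card_1_singleton_iff)
  then have "e \<subseteq> verts G" "card e = 2" "v \<in> e" using assms(1) by (auto simp: simple_graph_def)
  then obtain w where "e = {w, v}" "w \<noteq> v" by (auto simp: card_2_iff)
  then show thesis using that[of w] e \<open>e \<subseteq> verts G\<close> by auto
qed

text \<open>Two adjacent vertices of degree one can reach only each other, so they would be the
  whole graph.\<close>

lemma connected_graph_pendants_nonadjacent:
  assumes G: "connected_graph G" and "card (verts G) \<noteq> 2"
    and uv: "u \<in> verts G" "v \<in> verts G" "u \<noteq> v"
    and u: "{e \<in> edges G. u \<in> e} = {{u, v}}"
    and v: "{e \<in> edges G. v \<in> e} = {{u, v}}"
  shows False
proof -
  have "w \<in> {u, v}" if "(u, w) \<in> (adj_rel G)\<^sup>*" for w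
    using that
  proof induction
    case (step y z)
    then have "{y, z} \<in> {e \<in> edges G. u \<in> e} \<union> {e \<in> edges G. v \<in> e}"
      by (auto simp: adj_rel_def)
    then have "{y, z} = {u, v}" unfolding u v by blast
    then show ?case by (auto simp: doubleton_eq_iff)
  qed simp
  then have "verts G = {u, v}" using G uv by (auto simp: connected_graph_def)
  then show False using assms(2) uv by simp
qed

text \<open>Let \<open>f l\<close> be the unique neighbour of \<open>l\<close>. It is not pendant,
  since two pendant vertices cannot be adjacent here. An edge meeting \<open>L\<close> is thus a
  pendant edge, and all others lie in \<open>C\<close>.\<close>

lemma connected_graph_eq_pendant_extension:
  assumes simple: "simple_graph G" and con: "connected_graph G" and card: "card (verts G) \<noteq> 2"
  defines "L \<equiv> pendant_vertices G" and "C \<equiv> verts G - pendant_vertices G"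
  obtains f where "f ` L \<subseteq> C" "G = pendant_extension f L (C, edges G \<inter> Pow C)"
proof -
  have "\<exists>w. w \<in> verts G \<and> w \<noteq> l \<and> {e \<in> edges G. l \<in> e} = {{w, l}}" if "l \<in> L" for l
    using pendant_vertex_edgeE[OF simple, of l] that unfolding L_def by metis
  then obtain f where f: "\<And>l. l \<in> L \<Longrightarrow>
      f l \<in> verts G \<and> f l \<noteq> l \<and> {e \<in> edges G. l \<in> e} = {{f l, l}}" by metis
  have fC: "f l \<in> C" if l: "l \<in> L" for l
  proof (rule ccontr)
    assume "f l \<notin> C"
    then have fl: "f l \<in> L" using f[OF l] by (auto simp: C_def L_def)
    have "{f l, l} \<in> {e \<in> edges G. f l \<in> e}" using f[OF l] by auto
    then have "{e \<in> edges G. f l \<in> e} = {{f l, l}}" using f[OF fl] by auto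
    then show False
      using connected_graph_pendants_nonadjacent[OF con card, of "f l" l] f[OF l] l
      by (auto simp: L_def pendant_vertices_def)
  qed
  have "edges G = (edges G \<inter> Pow C) \<union> (\<lambda>l. {f l, l}) ` L"
  proof
    show "edges G \<subseteq> (edges G \<inter> Pow C) \<union> (\<lambda>l. {f l, l}) ` L"
    proof
      fix e assume e: "e \<in> edges G"
      show "e \<in> (edges G \<inter> Pow C) \<union> (\<lambda>l. {f l, l}) ` L"
      proof (cases "e \<inter> L = {}")
        case True
        then have "e \<subseteq> C" using e simple by (auto simp: simple_graph_def C_def L_def)
        then show ?thesis using e by simp
      next
        case False
        then obtain l where l: "l \<in> e" "l \<in> L" by blast
        then have "e = {f l, l}" using f[OF l(2)] e by blast
        then show ?thesis using l by blast
      qed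
    qed
    show "(edges G \<inter> Pow C) \<union> (\<lambda>l. {f l, l}) ` L \<subseteq> edges G" using f by blast
  qed
  moreover have "verts G = C \<union> L" by (auto simp: C_def L_def pendant_vertices_def)
  ultimately have "G = pendant_extension f L (C, edges G \<inter> Pow C)"
    by (simp add: pendant_extension_def prod_eq_iff)
  then show thesis using that fC by blast
qed

section \<open>The extremal graph: its pendant vertices and its core index\<close>

lemma pendant_clique_eq_pendant_extension:
  assumes "k < n"
  shows "pendant_clique n k = pendant_extension (\<lambda>_. 0) {n - k..<n} (clique {..<n - k})"
proof -
  have "{..<n} = {..<n - k} \<union> {n - k..<n}" by auto
  moreover have "{{0, j} | j. j \<in> {n - k..<n}} = (\<lambda>l. {0, l}) ` {n - k..<n}" by blast
  ultimately show ?thesis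
    by (simp only: pendant_clique_def complete_graph_def pendant_extension_def clique_def
        fst_conv snd_conv)
qed

lemma connected_graph_clique:
  assumes "c \<in> S" shows "connected_graph (clique S)"
proof (rule connected_graphI)
  show "c \<in> verts (clique S)" using assms by (simp add: clique_def)
  fix v assume "v \<in> verts (clique S)"
  then show "(v, c) \<in> (adj_rel (clique S))\<^sup>*"
    using assms by (cases "v = c") (auto simp: clique_def adj_rel_def intro!: r_into_rtrancl)
qed

text \<open>With at least three clique vertices, each of them has two neighbours in the clique. In a
  clique on two vertices, the one other than \<open>c\<close> would become pendant too.\<close>

lemma pendant_vertices_pendant_extension_clique:
  assumes "finite C" "finite L" "C \<inter> L = {}" "c \<in> C" "card C \<ge> 3"
  shows "pendant_vertices (pendant_extension (\<lambda>_. c) L (clique C)) = L"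
proof -
  let ?G = "pendant_extension (\<lambda>_. c) L (clique C)"
  have "degree ?G l = 1" if "l \<in> L" for l
  proof -
    have "{e \<in> edges ?G. l \<in> e} = {{c, l}}"
      using that assms by (auto simp: pendant_extension_def clique_def)
    then show ?thesis by (simp add: degree_def)
  qed
  moreover have "degree ?G v \<noteq> 1" if v: "v \<in> C" for v
  proof
    assume "degree ?G v = 1"
    then obtain e where e: "{e \<in> edges ?G. v \<in> e} = {e}"
      by (auto simp: degree_def card_1_singleton_iff)
    have "card (C - {v}) \<ge> 2" using v assms by simp
    then obtain T where "T \<subseteq> C - {v}" "card T = 2" by (meson obtain_subset_with_card_n)
    then obtain x y where xy: "x \<in> C" "y \<in> C" "x \<noteq> v" "y \<noteq> v" "x \<noteq> y"
      by (auto simp: card_2_iff)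
    then have "{x, v} \<in> {e \<in> edges ?G. v \<in> e}" "{y, v} \<in> {e \<in> edges ?G. v \<in> e}"
      using v by (auto simp: pendant_extension_def clique_def)
    then have "{x, v} = {y, v}" unfolding e by blast
    then show False using xy by (auto simp: doubleton_eq_iff)
  qed
  ultimately show ?thesis
    by (auto simp: pendant_vertices_def pendant_extension_def clique_def)
qed

lemma pendant_clique_in_connected_graphs_with_pendants:
  assumes "n \<ge> k + 3"
  shows "pendant_clique n k \<in> connected_graphs_with_pendants n k"
proof -
  have eq: "pendant_clique n k = pendant_extension (\<lambda>_. 0) {n - k..<n} (clique {..<n - k})"
    using assms by (intro pendant_clique_eq_pendant_extension) simp
  have "connected_graph (pendant_clique n k)"
    unfolding eq using assms
    by (intro connected_graph_pendant_extension connected_graph_clique[of 0])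
      (auto simp: clique_def)
  moreover have "simple_graph (pendant_clique n k)"
    unfolding eq using assms
    by (auto simp: simple_graph_def pendant_extension_def clique_def card_insert_if)
  moreover have "pendant_vertices (pendant_clique n k) = {n - k..<n}"
    unfolding eq using assms by (intro pendant_vertices_pendant_extension_clique) auto
  ultimately show ?thesis
    using assms by (simp add: connected_graphs_with_pendants_def pendant_clique_def)
qed

text \<open>The closed formula, rearranged over \<open>nat\<close> so that no core indices are
  subtracted.\<close>

lemma core_index_pendant_clique:
  assumes "k < n"
  shows "core_index (pendant_clique n k) + (2 ^ k - 1) * core_index (complete_graph (n - k - 1))
    = 2 ^ k * core_index (complete_graph (n - k)) + k"
proof -
  let ?M = "card {H \<in> connected_subgraphs (clique {..<n - k}). 0 \<in> verts H}"
  have "core_index (pendant_clique n k) = k + core_index (complete_graph (n - k)) + (2 ^ k - 1) * ?M"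
  proof -
    have "card {n - k..<n} = k" using assms by simp
    then show ?thesis
      unfolding pendant_clique_eq_pendant_extension[OF assms]
      using core_index_pendant_extension_clique[of "{..<n - k}" "{n - k..<n}" 0] assms
      by (simp only: card_lessThan) (simp add: ivl_disj_int)
  qed
  moreover have "core_index (complete_graph (n - k)) = ?M + core_index (complete_graph (n - k - 1))"
    using card_connected_subgraphs_clique_containing[of "{..<n - k}" 0] assms by simp
  \<comment> \<open>Writing \<open>2 ^ k\<close> as a successor removes the truncated subtraction in
    \<open>2 ^ k - 1\<close>.\<close>
  moreover obtain d where "(2::nat) ^ k = Suc d"
    by (metis not0_implies_Suc power_not_zero zero_neq_numeral)
  ultimately show ?thesis by (simp add: add_mult_distrib2)
qed

section \<open>The extremal bound and the final formula\<close>

text \<open>The upper bound for \<open>G\<close> depends only on \<open>card L = k\<close> and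
  \<open>card C = n - k\<close>, and the extremal graph attains it.\<close>

lemma core_index_le_pendant_clique:
  assumes G: "G \<in> connected_graphs_with_pendants n k" and n: "n \<ge> k + 3"
  shows "core_index G \<le> core_index (pendant_clique n k)"
proof -
  define L where "L = pendant_vertices G"
  define C where "C = verts G - pendant_vertices G"
  have simple: "simple_graph G" and con: "connected_graph G"
    and cV: "card (verts G) = n" and cL: "card L = k"
    using G by (auto simp: connected_graphs_with_pendants_def L_def)
  have fin: "finite C" "finite L" and LV: "L \<subseteq> verts G"
    using simple by (auto simp: simple_graph_def C_def L_def pendant_vertices_def)
  have cC: "card C = n - k"
    using fin LV cV cL by (simp add: C_def L_def card_Diff_subset)
  then obtain c where c: "c \<in> C" using n by fastforce
  obtain f where f: "f ` L \<subseteq> C" "G = pendant_extension f L (C, edges G \<inter> Pow C)"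
    using connected_graph_eq_pendant_extension[OF simple con] cV n unfolding L_def C_def by force
  have "core_index G \<le> card L + core_index (complete_graph (card C))
    + (2 ^ card L - 1) * card {H \<in> connected_subgraphs (clique C). c \<in> verts H}"
    using simple c f(1) fin
    by (subst f(2), intro core_index_pendant_extension_le)
      (auto simp: C_def L_def simple_graph_def)
  also have "\<dots> = core_index (pendant_clique n k)"
  proof -
    \<comment> \<open>The two cliques live on different types. Their counts agree because both equal
      the difference of the core indices of the complete graphs on \<open>n - k\<close> and
      \<open>n - k - 1\<close> vertices.\<close>
    have "card {H \<in> connected_subgraphs (clique C). c \<in> verts H}
        = card {H \<in> connected_subgraphs (clique {..<n - k}). 0 \<in> verts H}"
      using card_connected_subgraphs_clique_containing[OF fin(1) c]
        card_connected_subgraphs_clique_containing[of "{..<n - k}" 0] n cC by simp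
    then show ?thesis
      using n cC cL
      by (simp add: pendant_clique_eq_pendant_extension core_index_pendant_extension_clique
          ivl_disj_int)
  qed
  finally show ?thesis .
qed

theorem theorem5p1:
  fixes n k :: nat
  assumes "n \<ge> 4" and "k \<le> n - 3"
  shows "pendant_clique n k \<in> connected_graphs_with_pendants n k
    \<and> (\<forall>G :: 'a graph. G \<in> connected_graphs_with_pendants n k
          \<longrightarrow> core_index G \<le> core_index (pendant_clique n k))
    \<and> int (core_index (pendant_clique n k))
        = (2 ^ k - 1) * (int (core_index (complete_graph (n - k)))
                          - int (core_index (complete_graph (n - k - 1))))
          + int (core_index (complete_graph (n - k))) + int k
    \<and> (\<forall>m. core_index (complete_graph m)
        = (\<Sum>i = 1..m. (m choose i) * num_connected_labeled i))"
proof (intro conjI allI impI)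
  have n: "n \<ge> k + 3" using assms by linarith
  show "pendant_clique n k \<in> connected_graphs_with_pendants n k"
    using n by (rule pendant_clique_in_connected_graphs_with_pendants)
  show "core_index G \<le> core_index (pendant_clique n k)"
    if "G \<in> connected_graphs_with_pendants n k" for G :: "'a graph"
    using that n by (rule core_index_le_pendant_clique)
  have "int (core_index (pendant_clique n k)) + (2 ^ k - 1) * int (core_index (complete_graph (n - k - 1)))
    = 2 ^ k * int (core_index (complete_graph (n - k))) + int k"
  proof -
    \<comment> \<open>The truncated difference passes to \<open>int\<close> because
      \<open>2 ^ k\<close> is at least 1.\<close>
    have "int (2 ^ k - 1) = 2 ^ k - 1" by simp
    moreover have "k < n" using n by simp
    ultimately show ?thesis
      using arg_cong[OF core_index_pendant_clique[of k n], of int]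
      by (simp only: of_nat_add of_nat_mult of_nat_power of_nat_numeral)
  qed
  then show "int (core_index (pendant_clique n k))
        = (2 ^ k - 1) * (int (core_index (complete_graph (n - k)))
                          - int (core_index (complete_graph (n - k - 1))))
          + int (core_index (complete_graph (n - k))) + int k"
    by (simp add: algebra_simps)
  show "core_index (complete_graph m) = (\<Sum>i = 1..m. (m choose i) * num_connected_labeled i)" for m
    using core_index_clique_eq_sum[of "{..<m}"] by (simp add: complete_graph_eq_clique)
qed

end
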